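(* Let $\mathcal{D}\subset\mathbb{H}$ be open, bounded and connected, and let $q_0\in\partial\mathcal{D}$. For a continuous $F:\partial\mathcal{D}\to\mathbb{R}$ let $u^\epsilon(q)=\mathbb{E}[F\circ Q^{\epsilon,q}]$ for $q\in\mathcal{D}$, $\epsilon\in(0,1)$. (a) Assume that $q_0$ is walk-regular, and let $F:\partial\mathcal{D}\to\mathbb{R}$ be continuous. Then for every $\eta>0$ there exist $\hat\epsilon,\hat\delta>0$ such that for every $\epsilon\in(0,\hat\epsilon)$ there holds $|u^\epsilon(q)-F(q_0)|\le\eta$ for all $q\in B_{\hat\delta}(q_0)\cap\mathcal{D}$. (b) If $q_0$ is not walk-regular, then there exists a continuous function $F:\partial\mathcal{D}\to\mathbb{R}$ such that $$\lim_{\hat\epsilon,\hat\delta\to0}\ \sup\big\{|u^\epsilon(q)-F(q_0)|:\ \epsilon\in(0,\hat\epsilon),\ q\in B_{\hat\delta}(q_0)\cap\mathcal{D}\big\}>0.$$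
   Context: $\mathbb{H}=(\mathbb{R}^3,* )$ is the first Heisenberg group with $(x,y,z)*(x',y',z')=(x+x',y+y',z+z'+\frac12(xy'-yx'))$. The Korányi gauge is $|(x,y,z)|_K=((x^2+y^2)^2+16z^2)^{1/4}$, the metric is $d(q,q')=|q^{-1}*q'|_K$, $d(q,\partial\mathcal{D})$ is the distance to $\partial\mathcal{D}$ in this metric, and $B_r(q)=\{q'\in\mathbb{H}: d(q,q')<r\}$. Horizontal $\epsilon$-walk: let $w_1,w_2,\ldots$ be independent random variables, uniformly distributed on the Euclidean unit disc $B_1^2(0)\subset\mathbb{R}^2$ (on the countable product probability space $(\Omega,\mathcal{F},\mathbb{P})$ of the disc with normalized Lebesgue measure). For $q_0\in\mathcal{D}$ and $\epsilon\in(0,1)$ set $Q_0^{\epsilon,q_0}=q_0$ and, writing $w_n=(a_n,b_n)$ and $\lambda_{n-1}=\min\{\epsilon,d(Q^{\epsilon,q_0}_{n-1},\partial\mathcal{D})\}$, $$Q_n^{\epsilon,q_0}=Q_{n-1}^{\epsilon,q_0}*(\lambda_{n-1}a_n,\lambda_{n-1}b_n,0).$$ This sequence is a bounded martingale with values in $\mathcal{D}$, converging almost surely to a random variable $Q^{\epsilon,q_0}$ with values in $\partial\mathcal{D}$. A point $q_0\in\partial\mathcal{D}$ is walk-regular if for every $\eta,\delta>0$ there exist $\hat\delta\in(0,\delta)$ and $\hat\epsilon\in(0,1)$ such that $\mathbb{P}(Q^{\epsilon,q}\in B_\delta(q_0))\ge1-\eta$ for all $\epsilon\in(0,\hat\epsilon)$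 and all $q\in B_{\hat\delta}(q_0)\cap\mathcal{D}$. *)

theory Defs
  imports "HOL-Probability.Probability"
begin

text \<open>
  The gauge metric below induces the Euclidean topology and the same bounded sets, so open,
  bounded, connected, the boundary (\<open>frontier\<close>), continuity and limits are taken
  with respect to the library topology on \<open>real \<times> real \<times> real\<close>.
\<close>

type_synonym heis = "real \<times> real \<times> real"

fun heis_mult :: "heis \<Rightarrow> heis \<Rightarrow> heis" (infixl "\<star>" 70) where
  "(x, y, z) \<star> (x', y', z') = (x + x', y + y', z + z' + (x * y' - y * x') / 2)"

text \<open>The inverse with respect to \<open>(\<star>)\<close>, whose neutral element is the origin.\<close>

fun heis_inv :: "heis \<Rightarrow> heis" where
  "heis_inv (x, y, z) = (- x, - y, - z)"

lemma heis_mult_inv: "heis_inv q \<star> q = (0, 0, 0)" "q \<star> heis_inv q = (0, 0, 0)"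
  by (cases q; simp)+

fun koranyi_gauge :: "heis \<Rightarrow> real" where
  "koranyi_gauge (x, y, z) = root 4 ((x\<^sup>2 + y\<^sup>2)\<^sup>2 + 16 * z\<^sup>2)"

definition koranyi_dist :: "heis \<Rightarrow> heis \<Rightarrow> real" where
  "koranyi_dist q q' = koranyi_gauge (heis_inv q \<star> q')"

definition koranyi_ball :: "heis \<Rightarrow> real \<Rightarrow> heis set" where
  "koranyi_ball q r = {q'. koranyi_dist q q' < r}"

definition koranyi_infdist :: "heis \<Rightarrow> heis set \<Rightarrow> real" where
  "koranyi_infdist q A = (INF p\<in>A. koranyi_dist q p)"

definition unit_disc :: "(real \<times> real) set" where
  "unit_disc = ball 0 1"

definition disc_measure :: "(real \<times> real) measure" where
  "disc_measure = uniform_measure (restrict_space lborel unit_disc) unit_disc"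

definition walk_space :: "(nat \<Rightarrow> real \<times> real) measure" where
  "walk_space = (\<Pi>\<^sub>M n\<in>UNIV. disc_measure)"

text \<open>The \<open>n\<close>-th coordinate \<open>\<omega> n\<close> is the direction of step \<open>n + 1\<close>.\<close>

primrec walk :: "heis set \<Rightarrow> real \<Rightarrow> heis \<Rightarrow> (nat \<Rightarrow> real \<times> real) \<Rightarrow> nat \<Rightarrow> heis" where
  "walk D \<epsilon> q \<omega> 0 = q"
| "walk D \<epsilon> q \<omega> (Suc n) =
     (let Q = walk D \<epsilon> q \<omega> n;
          l = min \<epsilon> (koranyi_infdist Q (frontier D))
      in Q \<star> (l * fst (\<omega> n), l * snd (\<omega> n), 0))"

text \<open>
  The walk converges to a boundary point only almost surely; on the exceptional null set
  (for instance, all \<open>\<omega> n\<close> equal to 0) the limit is set to a fixed boundary point,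
  so that it takes values in the boundary everywhere and can be composed with
  functions that are only meaningful there.
\<close>

definition walk_limit :: "heis set \<Rightarrow> real \<Rightarrow> heis \<Rightarrow> (nat \<Rightarrow> real \<times> real) \<Rightarrow> heis" where
  "walk_limit D \<epsilon> q \<omega> =
     (if convergent (walk D \<epsilon> q \<omega>) \<and> lim (walk D \<epsilon> q \<omega>) \<in> frontier D
      then lim (walk D \<epsilon> q \<omega>)
      else (SOME p. p \<in> frontier D))"

definition walk_value :: "heis set \<Rightarrow> (heis \<Rightarrow> real) \<Rightarrow> real \<Rightarrow> heis \<Rightarrow> real" where
  "walk_value D F \<epsilon> q = (\<integral>\<omega>. F (walk_limit D \<epsilon> q \<omega>) \<partial>walk_space)"

definition walk_regular :: "heis set \<Rightarrow> heis \<Rightarrow> bool" where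
  "walk_regular D q\<^sub>0 \<longleftrightarrow>
     (\<forall>\<eta>>0. \<forall>\<delta>>0. \<exists>\<delta>'\<in>{0<..<\<delta>}. \<exists>\<epsilon>'\<in>{0<..<1}.
        \<forall>\<epsilon>\<in>{0<..<\<epsilon>'}. \<forall>q\<in>koranyi_ball q\<^sub>0 \<delta>' \<inter> D.
          measure walk_space
            {\<omega> \<in> space walk_space. walk_limit D \<epsilon> q \<omega> \<in> koranyi_ball q\<^sub>0 \<delta>} \<ge> 1 - \<eta>)"

end

theory Submission
  imports Defs
begin

text \<open>
  Apart from measurability, only the law of the limit point matters. At a walk-regular point
  most of the mass of this law lies where \<open>F\<close> is close to \<open>F q\<^sub>0\<close>, and \<open>F\<close> is bounded on
  the compact boundary. At an irregular point the gauge distance to \<open>q\<^sub>0\<close> serves as \<open>F\<close>: by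
  Markov's inequality, missing \<open>koranyi_ball q\<^sub>0 \<delta>\<close> with probability above \<open>\<eta>\<close> forces an
  expectation of at least \<open>\<delta> * \<eta>\<close>. The supremum is monotone in both parameters, so its
  limit exists and is its infimum.
\<close>

section \<open>The gauge metric in coordinates and its topology\<close>

text \<open>Projections replace the pattern-matching equation, so that measurability rules apply to
  arguments that are not literal triples. \<open>koranyi_dist_conv\<close> does the same for
  continuity.\<close>

lemma heis_mult_conv:
  "p \<star> q = (fst p + fst q, fst (snd p) + fst (snd q),
     snd (snd p) + snd (snd q) + (fst p * fst (snd q) - fst (snd p) * fst q) / 2)"
  by (cases p; cases q) simp

lemma koranyi_dist_conv:
  "koranyi_dist p q = root 4 (((fst q - fst p)\<^sup>2 + (fst (snd q) - fst (snd p))\<^sup>2)\<^sup>2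
     + 16 * (snd (snd q) - snd (snd p) - (fst p * fst (snd q) - fst (snd p) * fst q) / 2)\<^sup>2)"
  by (cases p; cases q) (simp add: koranyi_dist_def field_simps)

lemma koranyi_dist_nonneg: "koranyi_dist p q \<ge> 0"
  by (simp add: koranyi_dist_conv)

lemma koranyi_dist_self [simp]: "koranyi_dist p p = 0"
  by (simp add: koranyi_dist_conv)

lemma continuous_on_koranyi_dist_left: "continuous_on S (\<lambda>p. koranyi_dist p q)"
  unfolding koranyi_dist_conv by (intro continuous_intros) simp_all

lemma continuous_on_koranyi_dist_right: "continuous_on S (koranyi_dist p)"
  unfolding koranyi_dist_conv by (intro continuous_intros) simp_all

lemma koranyi_dist_pow4:
  "koranyi_dist p q ^ 4 = ((fst q - fst p)\<^sup>2 + (fst (snd q) - fst (snd p))\<^sup>2)\<^sup>2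
     + 16 * (snd (snd q) - snd (snd p) - (fst p * fst (snd q) - fst (snd p) * fst q) / 2)\<^sup>2"
  unfolding koranyi_dist_conv by (rule real_root_pow_pos2) auto

text \<open>The fourth power of the distance is a sum of two nonnegative terms, so the horizontal
  and the vertical term vanish separately in the limit. The horizontal one controls the first two
  coordinates, which are needed before the third can be extracted.\<close>

lemma koranyi_dist_tendsto_0_imp_tendsto:
  assumes "(\<lambda>n. koranyi_dist p (X n)) \<longlonglongrightarrow> 0"
  shows "X \<longlonglongrightarrow> p"
proof -
  define x where "x n = fst (X n)" for n
  define y where "y n = fst (snd (X n))" for n
  define z where "z n = snd (snd (X n))" for n
  define a b c where "a = fst p" and "b = fst (snd p)" and "c = snd (snd p)"
  have pow4: "koranyi_dist p (X n) ^ 4 =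
      ((x n - a)\<^sup>2 + (y n - b)\<^sup>2)\<^sup>2 + 16 * (z n - c - (a * y n - b * x n) / 2)\<^sup>2" for n
    unfolding koranyi_dist_pow4 by (simp add: x_def y_def z_def a_def b_def c_def)
  have lim4: "(\<lambda>n. koranyi_dist p (X n) ^ 4) \<longlonglongrightarrow> 0"
    using tendsto_power[OF assms, of 4] by simp
  have from_square: "u \<longlonglongrightarrow> 0" if "(\<lambda>n. (u n)\<^sup>2) \<longlonglongrightarrow> 0" for u :: "nat \<Rightarrow> real"
    using tendsto_real_sqrt[OF that] by (simp add: tendsto_rabs_zero_iff)
  have h: "(\<lambda>n. ((x n - a)\<^sup>2 + (y n - b)\<^sup>2)\<^sup>2) \<longlonglongrightarrow> 0"
    by (rule tendsto_sandwich[OF _ _ tendsto_const lim4]) (auto simp: pow4)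
  have v: "(\<lambda>n. (z n - c - (a * y n - b * x n) / 2)\<^sup>2) \<longlonglongrightarrow> 0"
    by (rule tendsto_sandwich[OF _ _ tendsto_const lim4]) (auto simp: pow4)
  note h = from_square[OF h]
  have "(\<lambda>n. (x n - a)\<^sup>2) \<longlonglongrightarrow> 0"
    by (rule tendsto_sandwich[OF _ _ tendsto_const h]) auto
  then have x: "x \<longlonglongrightarrow> a"
    by (rule LIM_zero_cancel[OF from_square])
  have "(\<lambda>n. (y n - b)\<^sup>2) \<longlonglongrightarrow> 0"
    by (rule tendsto_sandwich[OF _ _ tendsto_const h]) auto
  then have y: "y \<longlonglongrightarrow> b"
    by (rule LIM_zero_cancel[OF from_square])
  \<comment> \<open>The twist \<open>(a * y n - b * x n) / 2\<close> is added back to the vertical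
    term; its limit \<open>(a * b - b * a) / 2\<close> is zero.\<close>
  have "(\<lambda>n. (z n - c - (a * y n - b * x n) / 2) + (a * y n - b * x n) / 2 + c) \<longlonglongrightarrow> 
      0 + (a * b - b * a) / 2 + c"
    by (intro tendsto_add tendsto_diff tendsto_divide tendsto_mult tendsto_const x y from_square[OF v]) simp
  then have z: "z \<longlonglongrightarrow> c"
    by simp
  have "(\<lambda>n. (x n, y n, z n)) \<longlonglongrightarrow> (a, b, c)"
    by (intro tendsto_Pair x y z)
  then show ?thesis
    by (simp add: x_def y_def z_def a_def b_def c_def)
qed

text \<open>Otherwise points outside \<open>U\<close> at gauge distance below
  \<open>1 / (n + 1)\<close> would form a sequence converging to \<open>p\<close>. This turns
  Euclidean continuity of boundary data into closeness of values on gauge balls.\<close>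

lemma open_contains_koranyi_ball:
  assumes "open U" "p \<in> U"
  obtains r where "r > 0" "koranyi_ball p r \<subseteq> U"
proof (rule ccontr)
  assume *: "\<not> thesis"
  have "\<exists>q. koranyi_dist p q < 1 / real (Suc n) \<and> q \<notin> U" for n
    using * that[of "1 / real (Suc n)"] by (auto simp: koranyi_ball_def subset_eq)
  then obtain X where X: "\<And>n. koranyi_dist p (X n) < 1 / real (Suc n)" "\<And>n. X n \<notin> U"
    by metis
  have "(\<lambda>n. koranyi_dist p (X n)) \<longlonglongrightarrow> 0"
    by (rule tendsto_sandwich[OF _ _ tendsto_const LIMSEQ_Suc[OF lim_1_over_n]])
      (use X(1) in \<open>auto simp: koranyi_dist_nonneg less_imp_le\<close>)
  then have "eventually (\<lambda>n. X n \<in> U) sequentially"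
    using koranyi_dist_tendsto_0_imp_tendsto assms topological_tendstoD by blast
  with X(2) show False
    by simp
qed

lemma open_koranyi_ball: "open (koranyi_ball p r)"
  unfolding koranyi_ball_def
  by (intro open_Collect_less continuous_on_koranyi_dist_right continuous_on_const)

section \<open>Measurability of the walk and of its limit\<close>

text \<open>An infimum of continuous functions is upper semicontinuous: its strict sublevel sets are
  unions of open sets, even when \<open>A\<close> is uncountable.\<close>

lemma borel_measurable_koranyi_infdist:
  assumes "A \<noteq> {}"
  shows "(\<lambda>q. koranyi_infdist q A) \<in> borel_measurable borel"
proof (rule borel_measurableI_less)
  fix y :: real
  have "{q. koranyi_infdist q A < y} = (\<Union>p\<in>A. {q. koranyi_dist q p < y})"
    unfolding koranyi_infdist_def
    by (subst cINF_less_iff) (use assms koranyi_dist_nonneg in \<open>auto intro!: bdd_belowI2[of _ 0]\<close>)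
  also have "open \<dots>"
    by (intro open_UN ballI open_Collect_less continuous_on_koranyi_dist_left continuous_on_const)
  finally show "{q \<in> space borel. koranyi_infdist q A < y} \<in> sets borel"
    by simp
qed

lemma sets_disc_measure: "sets disc_measure = sets (restrict_space borel unit_disc)"
  unfolding disc_measure_def
  by (simp only: sets_uniform_measure, rule sets_restrict_space_cong) simp

lemma prob_space_disc_measure: "prob_space disc_measure"
proof -
  have disc: "emeasure (restrict_space lborel unit_disc) unit_disc = emeasure lborel unit_disc"
    by (rule emeasure_restrict_space) (auto simp: unit_disc_def)
  have "emeasure lborel unit_disc < \<infinity>"
    unfolding unit_disc_def by (rule emeasure_bounded_finite) simp
  moreover have "emeasure lborel unit_disc \<noteq> 0"
    using content_ball_pos[of 1 "0 :: real \<times> real"]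
    by (auto simp: unit_disc_def measure_def)
  ultimately show ?thesis
    unfolding disc_measure_def by (intro prob_space_uniform_measure) (auto simp: disc)
qed

lemma prob_space_walk_space: "prob_space walk_space"
  unfolding walk_space_def by (intro prob_space_PiM prob_space_disc_measure)

text \<open>A coordinate maps measurably into the trace of the Borel sets on the disc; the inclusion
  of the disc then carries it to the whole plane.\<close>

lemma measurable_walk_direction: "(\<lambda>\<omega>. \<omega> n) \<in> borel_measurable walk_space"
proof -
  have "(\<lambda>\<omega>. \<omega> n) \<in> measurable walk_space disc_measure"
    unfolding walk_space_def by measurable
  moreover have "(\<lambda>x. x) \<in> measurable disc_measure borel"
    by (simp add: measurable_cong_sets[OF sets_disc_measure refl] measurable_restrict_space1)
  ultimately show ?thesis
    by (rule measurable_compose)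
qed

lemma borel_measurable_walk:
  assumes "frontier D \<noteq> {}"
  shows "(\<lambda>\<omega>. walk D \<epsilon> q \<omega> n) \<in> borel_measurable walk_space"
proof (induction n)
  case 0
  show ?case by simp
next
  case (Suc n)
  have [measurable]: "(\<lambda>\<omega>. fst (f \<omega>)) \<in> borel_measurable walk_space"
      "(\<lambda>\<omega>. snd (f \<omega>)) \<in> borel_measurable walk_space"
    if "f \<in> borel_measurable walk_space"
    for f :: "(nat \<Rightarrow> real \<times> real) \<Rightarrow> 'b :: second_countable_topology \<times> 'c :: second_countable_topology"
    using that unfolding borel_prod[symmetric] by measurable
  \<comment> \<open>In this list \<open>this\<close> denotes the two projection facts just shown.
    They are instantiated to give the three coordinates of the current position and the two
    components of the next direction.\<close>
  note [measurable] = measurable_compose[OF Suc.IH borel_measurable_koranyi_infdist[OF assms]]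
    this[OF Suc.IH] this(1)[OF this(2)[OF Suc.IH]] this(2)[OF this(2)[OF Suc.IH]]
    this[OF measurable_walk_direction[of n]]
  show ?case
    unfolding walk.simps Let_def heis_mult_conv fst_conv snd_conv
    by (intro borel_measurable_Pair) measurable
qed

lemma borel_measurable_walk_limit:
  assumes "frontier D \<noteq> {}"
  shows "walk_limit D \<epsilon> q \<in> borel_measurable walk_space"
proof -
  note [measurable] = borel_measurable_walk[OF assms]
  have [measurable]: "(\<lambda>\<omega>. lim (walk D \<epsilon> q \<omega>)) \<in> borel_measurable walk_space"
    by (rule borel_measurable_lim_metric) measurable
  \<comment> \<open>By completeness convergence is the Cauchy property, which involves only
    countably many conditions on the walk.\<close>
  have [measurable]: "Measurable.pred walk_space (\<lambda>\<omega>. convergent (walk D \<epsilon> q \<omega>))"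
    unfolding Cauchy_convergent_iff[symmetric] pred_def
    by (rule sets_Collect_Cauchy) measurable
  have [measurable]: "frontier D \<in> sets borel"
    by simp
  show ?thesis
    unfolding walk_limit_def[abs_def] by measurable
qed

text \<open>The default value in \<open>walk_limit\<close> makes this true for every outcome, so
  bounds on the boundary become pointwise bounds on integrands.\<close>

lemma walk_limit_in_frontier:
  assumes "frontier D \<noteq> {}"
  shows "walk_limit D \<epsilon> q \<omega> \<in> frontier D"
  using assms by (auto simp: walk_limit_def some_in_eq)

text \<open>Since \<open>F\<close> is continuous only on the boundary, it is Borel only for the
  trace sigma-algebra there; \<open>walk_limit\<close> is therefore viewed as a map into that
  restricted space.\<close>

lemma borel_measurable_comp_walk_limit:
  assumes "frontier D \<noteq> {}" and "continuous_on (frontier D) F"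
  shows "(\<lambda>\<omega>. F (walk_limit D \<epsilon> q \<omega>)) \<in> borel_measurable walk_space"
proof -
  have "F \<in> borel_measurable (restrict_space borel (frontier D))"
    by (rule borel_measurable_continuous_on_restrict) fact
  moreover have "walk_limit D \<epsilon> q \<in> measurable walk_space (restrict_space borel (frontier D))"
    using walk_limit_in_frontier[OF assms(1)] borel_measurable_walk_limit[OF assms(1)]
    by (intro measurable_restrict_space2) auto
  ultimately show ?thesis
    using measurable_compose by blast
qed

section \<open>Bounds for expected boundary values\<close>

lemma continuous_on_frontier_bounded:
  fixes F :: "heis \<Rightarrow> real"
  assumes "bounded D" "continuous_on (frontier D) F"
  obtains M where "M > 0" "\<And>p. p \<in> frontier D \<Longrightarrow> \<bar>F p\<bar> \<le> M"
proof -
  have "compact (F ` frontier D)"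
    using assms by (intro compact_continuous_image compact_frontier_bounded)
  then have "bounded (F ` frontier D)"
    by (rule compact_imp_bounded)
  then show ?thesis
    using that by (auto simp: bounded_pos)
qed

context
  fixes D :: "heis set"
  assumes nonempty: "frontier D \<noteq> {}"
begin

interpretation prob_space walk_space
  by (rule prob_space_walk_space)

lemma walk_limit_event:
  "{\<omega> \<in> space walk_space. walk_limit D \<epsilon> q \<omega> \<in> koranyi_ball p r} \<in> events"
proof -
  note [measurable] = borel_measurable_walk_limit[OF nonempty]
  have [measurable]: "koranyi_ball p r \<in> sets borel"
    by (rule borel_open[OF open_koranyi_ball])
  show ?thesis by measurable
qed

lemma integrable_comp_walk_limit:
  fixes F :: "heis \<Rightarrow> real"
  assumes "continuous_on (frontier D) F" "\<And>p. p \<in> frontier D \<Longrightarrow> \<bar>F p\<bar> \<le> M"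
  shows "integrable walk_space (\<lambda>\<omega>. F (walk_limit D \<epsilon> q \<omega>))"
  using assms walk_limit_in_frontier[OF nonempty]
  by (intro integrable_const_bound[of _ M] borel_measurable_comp_walk_limit nonempty) auto

text \<open>The bound is uniform in \<open>\<epsilon>\<close> and \<open>q\<close>, which makes the
  suprema considered later those of bounded families.\<close>

lemma walk_value_le:
  assumes "continuous_on (frontier D) F" "\<And>p. p \<in> frontier D \<Longrightarrow> \<bar>F p\<bar> \<le> M"
  shows "\<bar>walk_value D F \<epsilon> q\<bar> \<le> M"
proof -
  have "\<bar>walk_value D F \<epsilon> q\<bar> \<le> (\<integral>\<omega>. \<bar>F (walk_limit D \<epsilon> q \<omega>)\<bar> \<partial>walk_space)"
    unfolding walk_value_def by (rule integral_abs_bound)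
  also have "\<dots> \<le> M"
    using assms walk_limit_in_frontier[OF nonempty]
    by (intro integral_le_const integrable_abs integrable_comp_walk_limit) auto
  finally show ?thesis .
qed

text \<open>The deviation of the integrand is at most \<alpha> when the limit hits the ball and at
  most \<open>2 * M\<close> otherwise. Integrating this pointwise bound leaves \<open>2 * M\<close>
  times the probability of a miss, which is at most \<beta>.\<close>

lemma walk_value_deviation_le:
  fixes M \<alpha> \<beta> :: real
  assumes "continuous_on (frontier D) F" "\<And>p. p \<in> frontier D \<Longrightarrow> \<bar>F p\<bar> \<le> M"
    and "M \<ge> 0" "\<alpha> \<ge> 0" "q\<^sub>0 \<in> frontier D"
    and near: "\<And>p. p \<in> frontier D \<inter> koranyi_ball q\<^sub>0 r \<Longrightarrow> \<bar>F p - F q\<^sub>0\<bar> \<le> \<alpha>"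
    and prob: "prob {\<omega> \<in> space walk_space. walk_limit D \<epsilon> q \<omega> \<in> koranyi_ball q\<^sub>0 r} \<ge> 1 - \<beta>"
  shows "\<bar>walk_value D F \<epsilon> q - F q\<^sub>0\<bar> \<le> \<alpha> + 2 * M * \<beta>"
proof -
  let ?X = "\<lambda>\<omega>. F (walk_limit D \<epsilon> q \<omega>)"
  let ?A = "{\<omega> \<in> space walk_space. walk_limit D \<epsilon> q \<omega> \<in> koranyi_ball q\<^sub>0 r}"
  let ?B = "space walk_space - ?A"
  note int = integrable_comp_walk_limit[OF assms(1,2), of \<epsilon> q]
  note A = walk_limit_event[of \<epsilon> q q\<^sub>0 r]
  have B: "?B \<in> events"
    using A by blast
  have "walk_value D F \<epsilon> q - F q\<^sub>0 = (\<integral>\<omega>. ?X \<omega> - F q\<^sub>0 \<partial>walk_space)"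
    unfolding walk_value_def by (subst Bochner_Integration.integral_diff[OF int]) (auto simp: prob_space)
  then have "\<bar>walk_value D F \<epsilon> q - F q\<^sub>0\<bar> \<le> (\<integral>\<omega>. \<bar>?X \<omega> - F q\<^sub>0\<bar> \<partial>walk_space)"
    using integral_abs_bound[of walk_space "\<lambda>\<omega>. ?X \<omega> - F q\<^sub>0"] by simp
  also have "\<dots> \<le> (\<integral>\<omega>. \<alpha> + 2 * M * indicator ?B \<omega> \<partial>walk_space)"
  proof (rule integral_mono)
    show "integrable walk_space (\<lambda>\<omega>. \<bar>?X \<omega> - F q\<^sub>0\<bar>)"
      using int by simp
    show "integrable walk_space (\<lambda>\<omega>. \<alpha> + 2 * M * indicator ?B \<omega>)"
      using B by (intro Bochner_Integration.integrable_add integrable_mult_right) (auto simp: emeasure_eq_measure)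
    fix \<omega> assume \<omega>: "\<omega> \<in> space walk_space"
    have fr: "walk_limit D \<epsilon> q \<omega> \<in> frontier D"
      by (rule walk_limit_in_frontier[OF nonempty])
    show "\<bar>?X \<omega> - F q\<^sub>0\<bar> \<le> \<alpha> + 2 * M * indicator ?B \<omega>"
    proof (cases "\<omega> \<in> ?A")
      case True
      then show ?thesis
        using near fr by simp
    next
      case False
      then show ?thesis
        using \<omega> assms(2)[OF fr] assms(2)[OF assms(5)] assms(4) by simp
    qed
  qed
  also have "\<dots> = \<alpha> + 2 * M * prob ?B"
    using B by (subst Bochner_Integration.integral_add) (auto simp: prob_space emeasure_eq_measure)
  also have "\<dots> \<le> \<alpha> + 2 * M * \<beta>"
    using prob prob_compl[OF A] \<open>M \<ge> 0\<close> by (intro add_left_mono mult_left_mono) auto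
  finally show ?thesis .
qed

text \<open>This is Markov's inequality: the integrand dominates \<open>r\<close> times the
  indicator of missing the ball, an event of probability at least \<beta>. Boundedness of
  \<open>D\<close> provides integrability.\<close>

lemma walk_value_koranyi_dist_ge:
  assumes "bounded D" "r > 0"
    and prob: "prob {\<omega> \<in> space walk_space. walk_limit D \<epsilon> q \<omega> \<in> koranyi_ball p r} \<le> 1 - \<beta>"
  shows "walk_value D (koranyi_dist p) \<epsilon> q \<ge> r * \<beta>"
proof -
  let ?X = "\<lambda>\<omega>. koranyi_dist p (walk_limit D \<epsilon> q \<omega>)"
  let ?A = "{\<omega> \<in> space walk_space. walk_limit D \<epsilon> q \<omega> \<in> koranyi_ball p r}"
  let ?B = "space walk_space - ?A"
  note A = walk_limit_event[of \<epsilon> q p r]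
  have B: "?B \<in> events"
    using A by blast
  obtain M where "\<And>x. x \<in> frontier D \<Longrightarrow> \<bar>koranyi_dist p x\<bar> \<le> M"
    using continuous_on_frontier_bounded[OF assms(1) continuous_on_koranyi_dist_right] by blast
  note int = integrable_comp_walk_limit[OF continuous_on_koranyi_dist_right this]
  have "r * \<beta> \<le> r * prob ?B"
    using prob prob_compl[OF A] \<open>r > 0\<close> by (intro mult_left_mono) auto
  also have "\<dots> = (\<integral>\<omega>. r * indicator ?B \<omega> \<partial>walk_space)"
    using B by simp
  also have "\<dots> \<le> (\<integral>\<omega>. ?X \<omega> \<partial>walk_space)"
    using B by (intro integral_mono int integrable_mult_right)
      (auto simp: emeasure_eq_measure koranyi_ball_def koranyi_dist_nonneg split: split_indicator)
  finally show ?thesis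
    unfolding walk_value_def .
qed

end

section \<open>Monotone limits in two parameters\<close>

text \<open>The limit is the infimum over the open positive quadrant, which exists and is at least
  \<open>c\<close> by the assumed lower bound.\<close>

lemma tendsto_at_right_prod_mono:
  fixes S :: "real \<Rightarrow> real \<Rightarrow> real"
  assumes mono: "\<And>a b a' b'. \<lbrakk>0 < a; a \<le> a'; 0 < b; b \<le> b'\<rbrakk> \<Longrightarrow> S a b \<le> S a' b'"
    and lower: "\<And>a b. \<lbrakk>0 < a; 0 < b\<rbrakk> \<Longrightarrow> c \<le> S a b"
  obtains L where "c \<le> L" "((\<lambda>(a, b). S a b) \<longlongrightarrow> L) (at_right 0 \<times>\<^sub>F at_right 0)"
proof -
  define L where "L = (INF (a, b)\<in>{0<..} \<times> {0<..}. S a b)"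
  have bdd: "bdd_below ((\<lambda>(a, b). S a b) ` ({0<..} \<times> {0<..}))"
    using lower by (auto intro!: bdd_belowI)
  have L_le: "L \<le> S a b" if "0 < a" "0 < b" for a b
    unfolding L_def using cINF_lower[OF bdd, of "(a, b)"] that by simp
  have "c \<le> L"
    unfolding L_def by (rule cINF_greatest) (auto intro: lower)
  moreover have "((\<lambda>(a, b). S a b) \<longlongrightarrow> L) (at_right 0 \<times>\<^sub>F at_right 0)"
  proof (rule order_tendstoI)
    have box: "eventually (\<lambda>x. (0 < fst x \<and> fst x < s) \<and> (0 < snd x \<and> snd x < t)) (at_right 0 \<times>\<^sub>F at_right 0)"
      if "0 < s" "0 < t" for s t :: real
      using that by (intro eventually_prodI) (auto simp: eventually_at_right_field)
    fix y
    \<comment> \<open>Only positivity of both parameters matters here, so the box with sides 1 is an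
      arbitrary choice.\<close>
    show "eventually (\<lambda>x. y < (case x of (a, b) \<Rightarrow> S a b)) (at_right 0 \<times>\<^sub>F at_right 0)"
      if "y < L"
      using box[OF zero_less_one zero_less_one]
      by eventually_elim (use that L_le in force)
    show "eventually (\<lambda>x. (case x of (a, b) \<Rightarrow> S a b) < y) (at_right 0 \<times>\<^sub>F at_right 0)"
      if "L < y"
    proof -
      \<comment> \<open>One pair with value below \<open>y\<close> suffices: by monotonicity the
        bound extends to the whole box below that pair.\<close>
      obtain s t where st: "0 < s" "0 < t" "S s t < y"
        using \<open>L < y\<close> cINF_less_iff[OF _ bdd, of y] unfolding L_def by (force simp: greaterThan_non_empty)
      show ?thesis
        using box[OF st(1,2)]
      proof eventually_elim
        case (elim x)
        then show ?case
          using mono[of "fst x" s "snd x" t] st(3) by (simp add: case_prod_unfold)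
      qed
    qed
  qed
  ultimately show ?thesis
    by (rule that)
qed

section \<open>Regular and irregular boundary points\<close>

lemma walk_regular_imp_boundary_values:
  assumes D: "bounded D" "q\<^sub>0 \<in> frontier D" and reg: "walk_regular D q\<^sub>0"
    and F: "continuous_on (frontier D) F" and "\<eta> > 0"
  shows "\<exists>\<epsilon>'\<in>{0<..<1}. \<exists>\<delta>'>0. \<forall>\<epsilon>\<in>{0<..<\<epsilon>'}. \<forall>q\<in>koranyi_ball q\<^sub>0 \<delta>' \<inter> D.
    \<bar>walk_value D F \<epsilon> q - F q\<^sub>0\<bar> \<le> \<eta>"
proof -
  have ne: "frontier D \<noteq> {}"
    using D by auto
  obtain M where M: "M > 0" "\<And>p. p \<in> frontier D \<Longrightarrow> \<bar>F p\<bar> \<le> M"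
    using continuous_on_frontier_bounded[OF D(1) F] by blast
  obtain e where e: "e > 0" "\<And>p. p \<in> frontier D \<Longrightarrow> dist p q\<^sub>0 < e \<Longrightarrow> \<bar>F p - F q\<^sub>0\<bar> < \<eta> / 2"
    using F D(2) \<open>\<eta> > 0\<close> unfolding continuous_on_iff dist_real_def by (metis half_gt_zero)
  obtain r where r: "r > 0" "koranyi_ball q\<^sub>0 r \<subseteq> ball q\<^sub>0 e"
    using open_contains_koranyi_ball[of "ball q\<^sub>0 e" q\<^sub>0] e(1) by auto
  have near: "\<bar>F p - F q\<^sub>0\<bar> \<le> \<eta> / 2" if "p \<in> frontier D \<inter> koranyi_ball q\<^sub>0 r" for p
    using that e(2)[of p] r(2) by (force simp: dist_commute)
  \<comment> \<open>Chosen so that \<open>2 * M * \<beta> = \<eta> / 2\<close>; continuity of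
    \<open>F\<close> accounts for the other half of \<eta>. The radius \<open>r\<close> plays the
    role of \<delta> in \<open>walk_regular\<close>.\<close>
  define \<beta> where "\<beta> = \<eta> / (4 * M)"
  have "\<beta> > 0"
    using M(1) \<open>\<eta> > 0\<close> by (simp add: \<beta>_def)
  then obtain \<delta>' \<epsilon>' where *: "\<delta>' \<in> {0<..<r}" "\<epsilon>' \<in> {0<..<1}"
      "\<And>\<epsilon> q. \<epsilon> \<in> {0<..<\<epsilon>'} \<Longrightarrow> q \<in> koranyi_ball q\<^sub>0 \<delta>' \<inter> D \<Longrightarrow>
        measure walk_space {\<omega> \<in> space walk_space. walk_limit D \<epsilon> q \<omega> \<in> koranyi_ball q\<^sub>0 r} \<ge> 1 - \<beta>"
    using reg r(1) unfolding walk_regular_def by meson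
  have "\<bar>walk_value D F \<epsilon> q - F q\<^sub>0\<bar> \<le> \<eta>"
    if "\<epsilon> \<in> {0<..<\<epsilon>'}" "q \<in> koranyi_ball q\<^sub>0 \<delta>' \<inter> D" for \<epsilon> q
    using walk_value_deviation_le[OF ne F M(2) _ _ D(2) near *(3)[OF that]] M(1) \<open>\<eta> > 0\<close>
    by (simp add: \<beta>_def)
  with *(1,2) show ?thesis
    by (meson greaterThanLessThan_iff)
qed

text \<open>The constants \<eta> and \<delta> from the negated definition stay fixed while the
  parameters shrink, so \<open>\<delta> * \<eta>\<close> is a common positive lower bound for all
  suprema and hence for their limit.\<close>

lemma not_walk_regular_imp_oscillation:
  assumes D: "bounded D" "q\<^sub>0 \<in> frontier D" and irreg: "\<not> walk_regular D q\<^sub>0"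
  obtains L where "L > 0"
    "((\<lambda>(\<epsilon>', \<delta>'). SUP (\<epsilon>, q)\<in>{0<..<\<epsilon>'} \<times> (koranyi_ball q\<^sub>0 \<delta>' \<inter> D).
        \<bar>walk_value D (koranyi_dist q\<^sub>0) \<epsilon> q - koranyi_dist q\<^sub>0 q\<^sub>0\<bar>) \<longlongrightarrow> L)
     (at_right 0 \<times>\<^sub>F at_right 0)"
proof -
  have ne: "frontier D \<noteq> {}"
    using D by auto
  obtain \<eta> \<delta> where "\<eta> > 0" "\<delta> > 0" and none:
    "\<not> (\<exists>\<delta>'\<in>{0<..<\<delta>}. \<exists>\<epsilon>'\<in>{0<..<1}. \<forall>\<epsilon>\<in>{0<..<\<epsilon>'}. \<forall>q\<in>koranyi_ball q\<^sub>0 \<delta>' \<inter> D.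
        measure walk_space {\<omega> \<in> space walk_space. walk_limit D \<epsilon> q \<omega> \<in> koranyi_ball q\<^sub>0 \<delta>} \<ge> 1 - \<eta>)"
    using irreg unfolding walk_regular_def by blast
  have irreg': "\<exists>\<epsilon>\<in>{0<..<\<epsilon>'}. \<exists>q\<in>koranyi_ball q\<^sub>0 \<delta>' \<inter> D.
        measure walk_space {\<omega> \<in> space walk_space. walk_limit D \<epsilon> q \<omega> \<in> koranyi_ball q\<^sub>0 \<delta>} < 1 - \<eta>"
    if "\<delta>' \<in> {0<..<\<delta>}" "\<epsilon>' \<in> {0<..<1}" for \<delta>' \<epsilon>'
    using none that unfolding not_le[symmetric] by blast
  let ?f = "\<lambda>(\<epsilon>, q). \<bar>walk_value D (koranyi_dist q\<^sub>0) \<epsilon> q - koranyi_dist q\<^sub>0 q\<^sub>0\<bar>"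
  let ?I = "\<lambda>\<epsilon>' \<delta>'. {0<..<\<epsilon>'} \<times> (koranyi_ball q\<^sub>0 \<delta>' \<inter> D)"
  define S where "S \<epsilon>' \<delta>' = (SUP x\<in>?I \<epsilon>' \<delta>'. ?f x)" for \<epsilon>' \<delta>'
  obtain M where M: "\<And>x. x \<in> frontier D \<Longrightarrow> \<bar>koranyi_dist q\<^sub>0 x\<bar> \<le> M"
    using continuous_on_frontier_bounded[OF D(1) continuous_on_koranyi_dist_right] by blast
  have bdd: "bdd_above (?f ` X)" for X
    using walk_value_le[OF ne continuous_on_koranyi_dist_right M] by (auto intro!: bdd_aboveI)
  \<comment> \<open>The monotonicity rule for real suprema asks for a nonempty smaller index set.
    Every gauge ball around \<open>q\<^sub>0\<close> is open and therefore meets \<open>D\<close>,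
    as \<open>q\<^sub>0\<close> lies in the closure.\<close>
  have nonempty: "?I a b \<noteq> {}" if "0 < a" "0 < b" for a b :: real
  proof -
    have "q\<^sub>0 \<in> koranyi_ball q\<^sub>0 b"
      using that by (simp add: koranyi_ball_def)
    moreover have "q\<^sub>0 \<in> closure D"
      using D(2) by (simp add: frontier_def)
    ultimately have "koranyi_ball q\<^sub>0 b \<inter> D \<noteq> {}"
      using open_Int_closure_eq_empty[OF open_koranyi_ball] by blast
    moreover have "a / 2 \<in> {0<..<a}"
      using that by simp
    ultimately show ?thesis by blast
  qed
  have mono: "S a b \<le> S a' b'" if "0 < a" "a \<le> a'" "0 < b" "b \<le> b'" for a b a' b'
    unfolding S_def using that
    by (intro cSUP_subset_mono nonempty bdd) (auto simp: koranyi_ball_def)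
  have lower: "\<delta> * \<eta> \<le> S a b" if pos: "0 < a" "0 < b" for a b
  proof -
    \<comment> \<open>The minima with \<open>\<delta>/2\<close> and \<open>1/2\<close> bring
      arbitrary positive \<open>a\<close> and \<open>b\<close> into the open ranges required by
      \<open>irreg'\<close>, while shrinking the index set of the supremum.\<close>
    obtain \<epsilon> q where \<epsilon>q: "\<epsilon> \<in> {0<..<min a (1/2)}" "q \<in> koranyi_ball q\<^sub>0 (min b (\<delta>/2)) \<inter> D"
      "measure walk_space {\<omega> \<in> space walk_space. walk_limit D \<epsilon> q \<omega> \<in> koranyi_ball q\<^sub>0 \<delta>} < 1 - \<eta>"
      using irreg'[of "min b (\<delta>/2)" "min a (1/2)"] pos \<open>\<delta> > 0\<close> by force
    have "\<delta> * \<eta> \<le> walk_value D (koranyi_dist q\<^sub>0) \<epsilon> q"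
      using walk_value_koranyi_dist_ge[OF ne D(1) \<open>\<delta> > 0\<close> less_imp_le[OF \<epsilon>q(3)]] .
    \<comment> \<open>The subtracted boundary value is the distance from \<open>q\<^sub>0\<close> to
      itself, which is zero.\<close>
    also have "\<dots> \<le> ?f (\<epsilon>, q)"
      by simp
    also have "\<dots> \<le> S a b"
      unfolding S_def using \<epsilon>q(1,2) by (intro cSUP_upper bdd) (auto simp: koranyi_ball_def)
    finally show ?thesis .
  qed
  obtain L where "\<delta> * \<eta> \<le> L" "((\<lambda>(a, b). S a b) \<longlongrightarrow> L) (at_right 0 \<times>\<^sub>F at_right 0)"
    using tendsto_at_right_prod_mono[of S, OF mono lower] by blast
  moreover have "\<delta> * \<eta> > 0"
    using \<open>\<delta> > 0\<close> \<open>\<eta> > 0\<close> by simp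
  ultimately show ?thesis
    using that[of L] unfolding S_def by simp
qed

theorem theorem7p3:
  fixes D :: "heis set" and q\<^sub>0 :: heis
  assumes "open D" and "bounded D" and "connected D" and "q\<^sub>0 \<in> frontier D"
  shows
    "(walk_regular D q\<^sub>0 \<longrightarrow>
       (\<forall>F :: heis \<Rightarrow> real. continuous_on (frontier D) F \<longrightarrow>
         (\<forall>\<eta>>0. \<exists>\<epsilon>'\<in>{0<..<1}. \<exists>\<delta>'>0.
            \<forall>\<epsilon>\<in>{0<..<\<epsilon>'}. \<forall>q\<in>koranyi_ball q\<^sub>0 \<delta>' \<inter> D.
              \<bar>walk_value D F \<epsilon> q - F q\<^sub>0\<bar> \<le> \<eta>)))
     \<and> (\<not> walk_regular D q\<^sub>0 \<longrightarrow>
       (\<exists>F :: heis \<Rightarrow> real. continuous_on (frontier D) F \<and>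
         (\<exists>L>0.
            ((\<lambda>(\<epsilon>', \<delta>'). SUP (\<epsilon>, q)\<in>{0<..<\<epsilon>'} \<times> (koranyi_ball q\<^sub>0 \<delta>' \<inter> D).
                \<bar>walk_value D F \<epsilon> q - F q\<^sub>0\<bar>) \<longlongrightarrow> L)
            (at_right 0 \<times>\<^sub>F at_right 0))))"
proof (intro conjI impI allI)
  fix F :: "heis \<Rightarrow> real" and \<eta> :: real
  assume "walk_regular D q\<^sub>0" "continuous_on (frontier D) F" "\<eta> > 0"
  then show "\<exists>\<epsilon>'\<in>{0<..<1}. \<exists>\<delta>'>0. \<forall>\<epsilon>\<in>{0<..<\<epsilon>'}. \<forall>q\<in>koranyi_ball q\<^sub>0 \<delta>' \<inter> D.
      \<bar>walk_value D F \<epsilon> q - F q\<^sub>0\<bar> \<le> \<eta>"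
    using assms by (intro walk_regular_imp_boundary_values)
next
  assume "\<not> walk_regular D q\<^sub>0"
  then show "\<exists>F :: heis \<Rightarrow> real. continuous_on (frontier D) F \<and>
      (\<exists>L>0. ((\<lambda>(\<epsilon>', \<delta>'). SUP (\<epsilon>, q)\<in>{0<..<\<epsilon>'} \<times> (koranyi_ball q\<^sub>0 \<delta>' \<inter> D).
          \<bar>walk_value D F \<epsilon> q - F q\<^sub>0\<bar>) \<longlongrightarrow> L) (at_right 0 \<times>\<^sub>F at_right 0))"
    using not_walk_regular_imp_oscillation[OF assms(2,4)] continuous_on_koranyi_dist_right by metis
qed

end
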